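(* For the quadratic function $f_2(x)=\frac{L}{2}\|x\|^2$ in $\mathcal{F}_L(\mathbb{R}^d)$, both OGM1 and OGM2 exactly achieve the convergence bound $$f(x_N)-f(x_* )\le \frac{LR^2}{2\theta_N^2}\le\frac{LR^2}{(N+1)(N+1+\sqrt2)}$$ (in the sense of its first inequality), i.e., $$f_2(x_N)-f_2(x_* )=\frac{LR^2}{2\theta_N^2}.$$
   Context: Let $L>0$, $R>0$. $\mathcal{F}_L(\mathbb{R}^d)$ denotes the class of functions $f$ satisfying the following conditions: $f:\mathbb{R}^d\to\mathbb{R}$ is convex and continuously differentiable with $\|\nabla f(x)-\nabla f(y)\|\le L\|x-y\|$ for all $x,y\in\mathbb{R}^d$; the optimal set $X_*(f)=\arg\min_{x\in\mathbb{R}^d} f(x)$ is nonempty; and the distance between the initial point $x_0$ and an optimal solution $x_*\in X_*(f)$ is bounded by $R$, i.e. $\|x_0-x_*\|\le R$. $N$ is the number of iterations. The numbers $\theta_0,\dots,\theta_N$ are defined by $\theta_0=1$ and, for $i=0,\dots,N-1$, $\theta_{i+1}=\frac{1+\sqrt{1+4\theta_i^2}}{2}$ if $i\le N-2$ and $\theta_{i+1}=\frac{1+\sqrt{1+8\theta_i^2}}{2}$ if $i=N-1$. OGM1: input $f\in\mathcal{F}_L(\mathbb{R}^d)$, $x_0\in\mathbb{R}^d$, $y_0=x_0$. For $i=0,\dots,N-1$: $$y_{i+1}=x_i-\tfrac1L\nabla f(x_i),\qquad x_{i+1}=y_{i+1}+\frac{\theta_i-1}{\theta_{i+1}}(y_{i+1}-y_i)+\frac{\theta_i}{\theta_{i+1}}(y_{i+1}-x_i).$$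 OGM2: input $f\in\mathcal{F}_L(\mathbb{R}^d)$, $x_0\in\mathbb{R}^d$, $y_0=x_0$. For $i=0,\dots,N-1$: $$y_{i+1}=x_i-\tfrac1L\nabla f(x_i),\quad z_{i+1}=x_0-\tfrac1L\sum_{k=0}^i 2\theta_k\nabla f(x_k),\quad x_{i+1}=\Big(1-\frac1{\theta_{i+1}}\Big)y_{i+1}+\frac1{\theta_{i+1}}z_{i+1}.$$ $\{y_i\}$ is called the primary sequence and $\{x_i\}$ the secondary sequence; $x_N$ is the last iterate of the secondary sequence. The displayed convergence bound is known to hold for $x_N$ of OGM1 and OGM2 for functions $f\in\mathcal{F}_L(\mathbb{R}^d)$.
   Formalization: The equality is stated for initial points with ‖x_0 − x_*‖ = R (shown to exist) instead of ≤ R: for f_2 the left side is L‖x_0 − x_*‖²/(2θ_N²), so at smaller distance, e.g. x_0 = x_* = 0, the equality fails. *)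

theory Defs
  imports "HOL-Analysis.Analysis"
begin

definition grad :: "('a::real_inner \<Rightarrow> real) \<Rightarrow> 'a \<Rightarrow> 'a" where
  "grad f x = (THE g. GDERIV f x :> g)"

lemma grad_eqI:
  assumes "GDERIV f x :> g"
  shows "grad f x = g"
  unfolding grad_def
proof (rule the_equality)
  show "GDERIV f x :> g" by (rule assms)
next
  fix h assume "GDERIV f x :> h"
  with assms have "(\<lambda>v. inner v h) = (\<lambda>v. inner v g)"
    unfolding gderiv_def by (metis has_derivative_unique)
  then have "inner (h - g) h = inner (h - g) g"
    by metis
  then have "inner (h - g) (h - g) = 0"
    by (simp only: inner_diff_right diff_self)
  then show "h = g"
    by simp
qed

definition argmin_set :: "('a \<Rightarrow> real) \<Rightarrow> 'a set" where
  "argmin_set f = {x. is_arg_min f (\<lambda>_. True) x}"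

(* The class F_L(R^d). It depends on the initial point x0 and the radius R as well,
   through the bound on the distance from x0 to a minimiser; non-emptiness of the
   set of minimisers is the existential in the last conjunct. *)
definition FL :: "real \<Rightarrow> real \<Rightarrow> 'a \<Rightarrow> ('a::euclidean_space \<Rightarrow> real) set" where
  "FL L R x0 = {f. convex_on UNIV f
     \<and> (\<forall>x. f differentiable (at x)) \<and> continuous_on UNIV (grad f)
     \<and> (\<forall>x y. norm (grad f x - grad f y) \<le> L * norm (x - y))
     \<and> (\<exists>xs \<in> argmin_set f. norm (x0 - xs) \<le> R)}"

(* theta N i is meant for i <= N only. The last index i + 1 = N has the factor 8;
   the condition i <= N - 2 is written i + 2 <= N to avoid truncated subtraction. *)
fun theta :: "nat \<Rightarrow> nat \<Rightarrow> real" where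
  "theta N 0 = 1"
| "theta N (Suc i) =
     (if i + 2 \<le> N then (1 + sqrt (1 + 4 * (theta N i)\<^sup>2)) / 2
      else (1 + sqrt (1 + 8 * (theta N i)\<^sup>2)) / 2)"

(* The iterates of both methods are meant for indices up to the iteration count N. *)
fun ogm1_y ogm1_x ::
  "real \<Rightarrow> nat \<Rightarrow> ('a::euclidean_space \<Rightarrow> real) \<Rightarrow> 'a \<Rightarrow> nat \<Rightarrow> 'a" where
  "ogm1_y L N f x0 0 = x0"
| "ogm1_y L N f x0 (Suc i) = ogm1_x L N f x0 i - (1 / L) *\<^sub>R grad f (ogm1_x L N f x0 i)"
| "ogm1_x L N f x0 0 = x0"
| "ogm1_x L N f x0 (Suc i) = ogm1_y L N f x0 (Suc i)
     + ((theta N i - 1) / theta N (Suc i)) *\<^sub>R (ogm1_y L N f x0 (Suc i) - ogm1_y L N f x0 i)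
     + (theta N i / theta N (Suc i)) *\<^sub>R (ogm1_y L N f x0 (Suc i) - ogm1_x L N f x0 i)"

(* OGM2 never uses z_0; the value x0 is the empty-sum case of the defining formula. *)
fun ogm2_y ogm2_z ogm2_x ::
  "real \<Rightarrow> nat \<Rightarrow> ('a::euclidean_space \<Rightarrow> real) \<Rightarrow> 'a \<Rightarrow> nat \<Rightarrow> 'a" where
  "ogm2_y L N f x0 0 = x0"
| "ogm2_y L N f x0 (Suc i) = ogm2_x L N f x0 i - (1 / L) *\<^sub>R grad f (ogm2_x L N f x0 i)"
| "ogm2_z L N f x0 0 = x0"
| "ogm2_z L N f x0 (Suc i) =
     x0 - (1 / L) *\<^sub>R (\<Sum>k = 0..i. (2 * theta N k) *\<^sub>R grad f (ogm2_x L N f x0 k))"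
| "ogm2_x L N f x0 0 = x0"
| "ogm2_x L N f x0 (Suc i) = (1 - 1 / theta N (Suc i)) *\<^sub>R ogm2_y L N f x0 (Suc i)
     + (1 / theta N (Suc i)) *\<^sub>R ogm2_z L N f x0 (Suc i)"

definition f2 :: "real \<Rightarrow> 'a::euclidean_space \<Rightarrow> real" where
  "f2 L x = L / 2 * (norm x)\<^sup>2"

end

theory Submission
  imports Defs
begin

text \<open>
  For \<open>f2 L\<close> the gradient is \<open>L x\<close>, so a gradient step from anywhere lands on the minimiser
  \<open>0\<close> and \<open>y\<^sub>i = 0\<close> for \<open>i \<ge> 1\<close>. What is left of both recurrences gives
  \<open>x\<^sub>i = ((-1)\<^sup>i / \<theta>\<^sub>i) x\<^sub>0\<close>; for OGM2 the momentum sum is alternating and gives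
  \<open>z\<^sub>i = (-1)\<^sup>i x\<^sub>0\<close>. Only \<open>\<theta>\<^sub>0 = 1\<close> and \<open>\<theta>\<^sub>i > 0\<close> matter, not the recurrence of \<open>\<theta>\<close>.
\<close>

lemma gderiv_f2: "GDERIV (f2 L) x :> L *\<^sub>R x"
  unfolding f2_def power2_norm_eq_inner
  by (auto simp: gderiv_def inner_commute intro!: derivative_eq_intros)

lemma grad_f2: "grad (f2 L) x = L *\<^sub>R x"
  by (rule grad_eqI) (rule gderiv_f2)

lemma convex_on_f2:
  assumes "L \<ge> 0"
  shows "convex_on UNIV (f2 L)"
proof (rule convex_onI)
  fix t :: real and x y :: 'a
  assume "0 < t" "t < 1"
  \<comment> \<open>For the squared norm the gap in the convexity inequality is exactly
    \<open>t * (1 - t) * (norm (x - y))\<^sup>2\<close>.\<close>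
  then have "0 \<le> L / 2 * (t * (1 - t) * (norm (x - y))\<^sup>2)"
    using assms by simp
  also have "\<dots> = (1 - t) * f2 L x + t * f2 L y - f2 L ((1 - t) *\<^sub>R x + t *\<^sub>R y)"
    by (simp add: f2_def power2_norm_eq_inner inner_simps inner_commute field_simps)
  finally show "f2 L ((1 - t) *\<^sub>R x + t *\<^sub>R y) \<le> (1 - t) * f2 L x + t * f2 L y"
    by simp
qed simp

lemma argmin_set_f2:
  assumes "L > 0"
  shows "argmin_set (f2 L) = {0}"
proof -
  have min: "f2 L 0 < f2 L x \<longleftrightarrow> x \<noteq> 0" "\<not> f2 L x < f2 L 0" for x :: 'a
    using assms by (simp_all add: f2_def zero_less_mult_iff not_less)
  have "is_arg_min (f2 L) (\<lambda>_. True) x \<longleftrightarrow> x = 0" for x :: 'a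
    unfolding is_arg_min_def using min by blast
  then show ?thesis
    by (simp add: argmin_set_def)
qed

lemma f2_in_FL:
  assumes "L > 0" and "norm x0 \<le> R"
  shows "f2 L \<in> FL L R x0"
proof -
  have "f2 L differentiable (at x)" for x :: 'a
    using gderiv_f2[of L x] unfolding gderiv_def by (rule differentiableI)
  moreover have "continuous_on UNIV (grad (f2 L) :: 'a \<Rightarrow> 'a)"
    unfolding grad_f2 by (intro continuous_intros)
  ultimately show ?thesis
    using assms
    by (simp add: FL_def convex_on_f2 grad_f2 argmin_set_f2 flip: scaleR_right_diff_distrib)
qed

lemma theta_pos: "theta N i > 0"
  by (cases i) (simp_all add: add_pos_nonneg)

lemma ogm1_y_f2_Suc:
  assumes "L \<noteq> 0"
  shows "ogm1_y L N (f2 L) x0 (Suc i) = 0"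
  using assms by (simp add: grad_f2)

lemma ogm1_x_f2:
  assumes "L \<noteq> 0"
  shows "ogm1_x L N (f2 L) x0 i = ((- 1) ^ i / theta N i) *\<^sub>R x0"
proof (induction i)
  case 0
  show ?case by simp
next
  case (Suc i)
  \<comment> \<open>For \<open>i = 0\<close> the factor \<open>\<theta>\<^sub>0 - 1\<close> vanishes, otherwise \<open>y\<^sub>i\<close> does.\<close>
  have "(theta N i - 1) *\<^sub>R ogm1_y L N (f2 L) x0 i = 0"
    by (cases i) (simp_all add: ogm1_y_f2_Suc[OF assms] del: ogm1_y.simps(2) theta.simps(2))
  then have "((theta N i - 1) / theta N (Suc i)) *\<^sub>R ogm1_y L N (f2 L) x0 i = 0"
    by (simp only: scaleR_eq_0_iff divide_eq_0_iff) blast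
  moreover have "theta N i \<noteq> 0"
    using theta_pos[of N i] by simp
  \<comment> \<open>Only \<open>- (theta N i / theta N (Suc i)) *\<^sub>R x\<close> survives of the
    update, \<open>x\<close> being the previous iterate: the sign flips and \<open>theta N i\<close>
    cancels.\<close>
  ultimately show ?case
    unfolding ogm1_x.simps ogm1_y_f2_Suc[OF assms] Suc.IH by simp
qed

lemma ogm2_x_f2:
  assumes "L \<noteq> 0"
  shows "ogm2_x L N (f2 L) x0 i = ((- 1) ^ i / theta N i) *\<^sub>R x0"
\<comment> \<open>Strong induction, since \<open>ogm2_z\<close> sums the gradients at all earlier
  iterates.\<close>
proof (induction i rule: less_induct)
  case (less i)
  show ?case
  proof (cases i)
    case 0
    then show ?thesis by simp
  next
    case (Suc j)
    have "(\<Sum>k = 0..j. (2 * theta N k) *\<^sub>R grad (f2 L) (ogm2_x L N (f2 L) x0 k))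
        = (\<Sum>k = 0..j. (L * (2 * (- 1) ^ k)) *\<^sub>R x0)"
    proof (rule sum.cong[OF refl])
      fix k assume "k \<in> {0..j}"
      with Suc less.IH have "ogm2_x L N (f2 L) x0 k = ((- 1) ^ k / theta N k) *\<^sub>R x0"
        by simp
      \<comment> \<open>The weight cancels the denominator, so every term is \<plusminus> the same
        vector.\<close>
      then show "(2 * theta N k) *\<^sub>R grad (f2 L) (ogm2_x L N (f2 L) x0 k)
          = (L * (2 * (- 1) ^ k)) *\<^sub>R x0"
        using theta_pos[of N k] by (simp add: grad_f2)
    qed
    also have "\<dots> = (L * (\<Sum>k = 0..j. 2 * (- 1) ^ k)) *\<^sub>R x0"
      by (simp add: sum_distrib_left scaleR_sum_left)
    also have "(\<Sum>k = 0..j. 2 * (- 1) ^ k) = 1 + (- 1 :: real) ^ j"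
      by (induction j) simp_all
    finally have "ogm2_z L N (f2 L) x0 (Suc j) = (- 1) ^ Suc j *\<^sub>R x0"
      using assms by (simp add: scaleR_add_left)
    moreover have "ogm2_y L N (f2 L) x0 (Suc j) = 0"
      using assms by (simp add: grad_f2)
    ultimately show ?thesis
      unfolding Suc ogm2_x.simps by simp
  qed
qed

theorem theorem4p1:
  fixes L R :: real and N :: nat
  assumes "L > 0" and "R > 0"
  shows "(\<forall>x0 xs :: real ^ 'd. xs \<in> argmin_set (f2 L) \<and> norm (x0 - xs) \<le> R \<longrightarrow> f2 L \<in> FL L R x0)
    \<and> (\<exists>x0 xs :: real ^ 'd. xs \<in> argmin_set (f2 L) \<and> norm (x0 - xs) = R)
    \<and> (\<forall>x0 xs :: real ^ 'd. xs \<in> argmin_set (f2 L) \<and> norm (x0 - xs) = R \<longrightarrow>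
          f2 L (ogm1_x L N (f2 L) x0 N) - f2 L xs = L * R\<^sup>2 / (2 * (theta N N)\<^sup>2)
        \<and> f2 L (ogm2_x L N (f2 L) x0 N) - f2 L xs = L * R\<^sup>2 / (2 * (theta N N)\<^sup>2))"
proof (intro conjI allI impI)
  show "f2 L \<in> FL L R x0"
    if "xs \<in> argmin_set (f2 L) \<and> norm (x0 - xs) \<le> R" for x0 xs :: "real ^ 'd"
    using that assms(1) by (auto simp: argmin_set_f2 f2_in_FL)
next
  \<comment> \<open>Index types are nonempty, so the space has positive dimension and the sphere of
    radius \<open>R\<close> around the minimiser 0 has a point.\<close>
  obtain x0 :: "real ^ 'd" where "norm x0 = R"
    using vector_choose_size[of R] assms(2) by auto
  then show "\<exists>x0 xs :: real ^ 'd. xs \<in> argmin_set (f2 L) \<and> norm (x0 - xs) = R"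
    using assms(1) by (intro exI[of _ x0] exI[of _ 0]) (simp add: argmin_set_f2)
next
  fix x0 xs :: "real ^ 'd"
  assume *: "xs \<in> argmin_set (f2 L) \<and> norm (x0 - xs) = R"
  then have xs: "xs = 0" and "norm x0 = R"
    using assms(1) by (auto simp: argmin_set_f2)
  \<comment> \<open>Both methods end at this same point; squaring the norm removes its sign.\<close>
  then have val: "f2 L (((- 1) ^ N / theta N N) *\<^sub>R x0) - f2 L xs = L * R\<^sup>2 / (2 * (theta N N)\<^sup>2)"
    by (simp add: f2_def power_mult_distrib power_divide)
  have "L \<noteq> 0"
    using assms(1) by simp
  show "f2 L (ogm1_x L N (f2 L) x0 N) - f2 L xs = L * R\<^sup>2 / (2 * (theta N N)\<^sup>2)"
    unfolding ogm1_x_f2[OF \<open>L \<noteq> 0\<close>] by (rule val)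
  show "f2 L (ogm2_x L N (f2 L) x0 N) - f2 L xs = L * R\<^sup>2 / (2 * (theta N N)\<^sup>2)"
    unfolding ogm2_x_f2[OF \<open>L \<noteq> 0\<close>] by (rule val)
qed

end
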